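(* Let $P$ be a signed path with negative sections of odd length $N_1,\dots,N_k$ ($k\ge 0$), in order along $P$. Let $Q_0$ be the subpath preceding $N_1$ (possibly of length $0$), $Q_i$ the subpath between $N_i$ and $N_{i+1}$ for $1\le i\le k-1$, and $Q_k$ the subpath following $N_k$ (possibly of length $0$); when $k=0$, $Q_0=P$. Let $m_i$ be the number of positive edges in $Q_i$, $m_o=\sum_{i\text{ odd}}m_i$ and $m_e=\sum_{i\text{ even}}m_i$. Then $P$ is a parity signed graph if and only if $m_e-m_o\in\{1,0,-1\}$ when $k$ is odd, and $m_e-m_o\in\{0,-1,-2\}$ when $k$ is even. In particular, if $P$ has no odd negative sections, it is parity signed if and only if it has no positive edges; if $P$ has exactly one odd negative section, it is parity signed if and only if the numbers of positive edges on the two sides of that section differ by at most $1$.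
   Context: A signed graph is a pair $S=(G,\sigma)$ with $G$ a graph and $\sigma:E(G)\to\{+,-\}$. For a graph $G$ with $n$ vertices and a bijection $f:V(G)\to\{1,\dots,n\}$, define $\sigma_f(uv)=+$ if $f(u),f(v)$ have the same parity and $\sigma_f(uv)=-$ otherwise. $S$ is a parity signed graph if $\sigma=\sigma_f$ for some such bijection $f$. A positive (negative) section is a maximal connected subgraph all of whose edges are positive (negative); in a path each section is a subpath, called odd or even according to the parity of its length. *)

theory Defs
  imports Main
begin

datatype sign = Positive | Negative

type_synonym 'a graph = "'a set \<times> 'a set set"

abbreviation verts :: "'a graph \<Rightarrow> 'a set" where "verts G \<equiv> fst G"
abbreviation edges :: "'a graph \<Rightarrow> 'a set set" where "edges G \<equiv> snd G"

definition simple_graph :: "'a graph \<Rightarrow> bool" where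
  "simple_graph G \<longleftrightarrow> finite (verts G) \<and>
     (\<forall>e\<in>edges G. \<exists>u\<in>verts G. \<exists>v\<in>verts G. u \<noteq> v \<and> e = {u, v})"

definition subgraph :: "'a graph \<Rightarrow> 'a graph \<Rightarrow> bool" where
  "subgraph H G \<longleftrightarrow> simple_graph H \<and> verts H \<subseteq> verts G \<and> edges H \<subseteq> edges G"

definition connected_graph :: "'a graph \<Rightarrow> bool" where
  "connected_graph G \<longleftrightarrow> verts G \<noteq> {} \<and>
     (\<forall>u\<in>verts G. \<forall>v\<in>verts G. (u, v) \<in> {(x, y). {x, y} \<in> edges G}\<^sup>*)"

text \<open>Only the values of the sign function on the edges of the graph matter.\<close>

type_synonym 'a signed_graph = "'a graph \<times> ('a set \<Rightarrow> sign)"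

abbreviation graph_of :: "'a signed_graph \<Rightarrow> 'a graph" where "graph_of S \<equiv> fst S"
abbreviation sign_of :: "'a signed_graph \<Rightarrow> 'a set \<Rightarrow> sign" where "sign_of S \<equiv> snd S"

definition parity_sign :: "('a \<Rightarrow> nat) \<Rightarrow> 'a \<Rightarrow> 'a \<Rightarrow> sign" where
  "parity_sign f u v = (if even (f u) = even (f v) then Positive else Negative)"

definition parity_signed :: "'a signed_graph \<Rightarrow> bool" where
  "parity_signed S \<longleftrightarrow>
     (\<exists>f. bij_betw f (verts (graph_of S)) {1..card (verts (graph_of S))} \<and>
        (\<forall>u v. {u, v} \<in> edges (graph_of S) \<longrightarrow> sign_of S {u, v} = parity_sign f u v))"

definition monosigned :: "sign \<Rightarrow> 'a signed_graph \<Rightarrow> 'a graph \<Rightarrow> bool" where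
  "monosigned s S H \<longleftrightarrow> subgraph H (graph_of S) \<and> connected_graph H \<and>
     (\<forall>e\<in>edges H. sign_of S e = s)"

definition signed_section :: "sign \<Rightarrow> 'a signed_graph \<Rightarrow> 'a graph \<Rightarrow> bool" where
  "signed_section s S H \<longleftrightarrow> monosigned s S H \<and>
     (\<forall>H'. monosigned s S H' \<and> subgraph H H' \<longrightarrow> H' = H)"

definition odd_negative_sections :: "'a signed_graph \<Rightarrow> 'a graph set" where
  "odd_negative_sections S = {H. signed_section Negative S H \<and> odd (card (edges H))}"

definition num_positive :: "'a signed_graph \<Rightarrow> 'a graph \<Rightarrow> nat" where
  "num_positive S H = card {e \<in> edges H. sign_of S e = Positive}"

text \<open>A path is given together with the list of its vertices in order of traversal;
  positions on the path are counted from 0.\<close>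

definition subpath :: "'a list \<Rightarrow> nat \<Rightarrow> nat \<Rightarrow> 'a graph" where
  "subpath p a b = ((!) p ` {a..b}, {{p ! i, p ! Suc i} |i. a \<le> i \<and> i < b})"

definition path_along :: "'a graph \<Rightarrow> 'a list \<Rightarrow> bool" where
  "path_along G p \<longleftrightarrow> p \<noteq> [] \<and> distinct p \<and> G = subpath p 0 (length p - 1)"

definition first_pos :: "'a list \<Rightarrow> 'a graph \<Rightarrow> nat" where
  "first_pos p H = Min {j. j < length p \<and> p ! j \<in> verts H}"

definition last_pos :: "'a list \<Rightarrow> 'a graph \<Rightarrow> nat" where
  "last_pos p H = Max {j. j < length p \<and> p ! j \<in> verts H}"

text \<open>The piece with index \<open>i\<close> runs from the last vertex of the subgraph \<open>N i\<close> (or the start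
  of the path) to the first vertex of \<open>N (i + 1)\<close> (or the end of the path).\<close>

definition piece :: "'a list \<Rightarrow> nat \<Rightarrow> (nat \<Rightarrow> 'a graph) \<Rightarrow> nat \<Rightarrow> 'a graph" where
  "piece p k N i = subpath p
     (if i = 0 then 0 else last_pos p (N i))
     (if i = k then length p - 1 else first_pos p (N (i + 1)))"

text \<open>Every signed path has an enumeration of its odd negative sections in order along the path.\<close>

lemma monosigned_union:
  assumes H: "monosigned s S H" and K: "monosigned s S K"
    and x: "x \<in> verts H" "x \<in> verts K"
  shows "monosigned s S (verts H \<union> verts K, edges H \<union> edges K)" (is "monosigned s S ?U")
proof -
  let ?R = "\<lambda>G :: 'a graph. {(x, y). {x, y} \<in> edges G}\<^sup>*"
  have sub: "?R H \<subseteq> ?R ?U" "?R K \<subseteq> ?R ?U"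
    by (auto intro!: rtrancl_mono)
  have conn: "(u, v) \<in> ?R G" if "monosigned s S G" "u \<in> verts G" "v \<in> verts G" for G u v
    using that unfolding monosigned_def connected_graph_def by blast
  have to_x: "(u, x) \<in> ?R ?U" "(x, u) \<in> ?R ?U" if "u \<in> verts ?U" for u
  proof -
    have "(u, x) \<in> ?R H \<union> ?R K" "(x, u) \<in> ?R H \<union> ?R K"
      using that conn[OF H _ x(1)] conn[OF H x(1)] conn[OF K _ x(2)] conn[OF K x(2)]
      unfolding fst_conv by blast+
    then show "(u, x) \<in> ?R ?U" "(x, u) \<in> ?R ?U" using sub by blast+
  qed
  have "connected_graph ?U"
    unfolding connected_graph_def
  proof (intro conjI ballI)
    show "verts ?U \<noteq> {}" using x by auto
    show "(u, v) \<in> ?R ?U" if "u \<in> verts ?U" "v \<in> verts ?U" for u v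
      using to_x(1)[OF that(1)] to_x(2)[OF that(2)] by (rule rtrancl_trans)
  qed
  moreover have "simple_graph ?U"
    unfolding simple_graph_def
  proof (intro conjI ballI)
    show "finite (verts ?U)"
      using H K by (simp add: monosigned_def subgraph_def simple_graph_def)
    fix e assume "e \<in> edges ?U"
    then consider "e \<in> edges H" | "e \<in> edges K" by auto
    then show "\<exists>u\<in>verts ?U. \<exists>v\<in>verts ?U. u \<noteq> v \<and> e = {u, v}"
    proof cases
      case 1
      then obtain u v where "u \<in> verts H" "v \<in> verts H" "u \<noteq> v" "e = {u, v}"
        using H unfolding monosigned_def subgraph_def simple_graph_def by blast
      then show ?thesis by (intro bexI[of _ u] bexI[of _ v]) simp_all
    next
      case 2
      then obtain u v where "u \<in> verts K" "v \<in> verts K" "u \<noteq> v" "e = {u, v}"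
        using K unfolding monosigned_def subgraph_def simple_graph_def by blast
      then show ?thesis by (intro bexI[of _ u] bexI[of _ v]) simp_all
    qed
  qed
  ultimately show ?thesis
    using H K by (auto simp: monosigned_def subgraph_def)
qed

lemma signed_section_unique:
  assumes H: "signed_section s S H" and K: "signed_section s S K"
    and x: "x \<in> verts H" "x \<in> verts K"
  shows "H = K"
proof -
  let ?U = "(verts H \<union> verts K, edges H \<union> edges K)"
  have HK: "monosigned s S H" "monosigned s S K"
    using H K by (simp_all add: signed_section_def)
  have U: "monosigned s S ?U"
    using HK x by (rule monosigned_union)
  have "simple_graph H" "simple_graph K"
    using HK by (simp_all add: monosigned_def subgraph_def)
  then have "subgraph H ?U" "subgraph K ?U"
    by (simp_all add: subgraph_def)
  then have "?U = H" "?U = K"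
    using H K U unfolding signed_section_def by blast+
  then show ?thesis by (rule trans[OF sym])
qed

lemma odd_negative_sections_enumeration:
  assumes "path_along (graph_of P) p"
  obtains k :: nat and N where "N ` {1..k} = odd_negative_sections P"
    and "strict_mono_on {1..k} (\<lambda>i. first_pos p (N i))"
proof -
  let ?A = "odd_negative_sections P"
  have V: "verts (graph_of P) = set p"
  proof -
    have "{0..length p - 1} = {..<length p}"
      using assms unfolding path_along_def by (cases p) auto
    then show ?thesis
      using assms unfolding path_along_def subpath_def by (auto simp: set_conv_nth)
  qed
  have pos: "first_pos p H < length p \<and> p ! first_pos p H \<in> verts H" if "H \<in> ?A" for H
  proof -
    have "verts H \<noteq> {}" "verts H \<subseteq> set p"
      using that V unfolding odd_negative_sections_def signed_section_def monosigned_def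
        connected_graph_def subgraph_def by auto
    then obtain x where "x \<in> verts H" "x \<in> set p" by blast
    then have "{j. j < length p \<and> p ! j \<in> verts H} \<noteq> {}"
      unfolding in_set_conv_nth by blast
    moreover have "finite {j. j < length p \<and> p ! j \<in> verts H}" by simp
    ultimately show ?thesis unfolding first_pos_def using Min_in by blast
  qed
  have inj: "inj_on (first_pos p) ?A"
  proof (rule inj_onI)
    fix H K assume "H \<in> ?A" "K \<in> ?A" "first_pos p H = first_pos p K"
    then show "H = K"
      using pos[of H] pos[of K] signed_section_unique[of Negative P H K "p ! first_pos p H"]
      unfolding odd_negative_sections_def by auto
  qed
  have fin: "finite (first_pos p ` ?A)"
    by (rule finite_subset[of _ "{..<length p}"]) (use pos in auto)
  define xs where "xs = sorted_list_of_set (first_pos p ` ?A)"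
  define N where "N i = inv_into ?A (first_pos p) (xs ! (i - 1))" for i
  have xs: "set xs = first_pos p ` ?A" "sorted_wrt (<) xs"
    using fin unfolding xs_def by auto
  have key: "first_pos p (N i) = xs ! (i - 1)" if "i \<in> {1..length xs}" for i
  proof -
    have "xs ! (i - 1) \<in> first_pos p ` ?A"
      using that unfolding xs(1)[symmetric] by (intro nth_mem) auto
    then show ?thesis unfolding N_def by (rule f_inv_into_f)
  qed
  have ix: "{1..length xs} = Suc ` {..<length xs}"
    by (simp add: lessThan_atLeast0 image_Suc_atLeastLessThan atLeastLessThanSuc_atLeastAtMost)
  have "N ` {1..length xs} = inv_into ?A (first_pos p) ` ((!) xs ` {..<length xs})"
    unfolding ix image_image N_def by simp
  also have "(!) xs ` {..<length xs} = set xs" by (auto simp: set_conv_nth)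
  also have "inv_into ?A (first_pos p) ` set xs = ?A"
    using inj xs(1) by (simp add: inv_into_image_cancel)
  finally have "N ` {1..length xs} = ?A" .
  moreover have "strict_mono_on {1..length xs} (\<lambda>i. first_pos p (N i))"
  proof (rule strict_mono_onI)
    fix i j assume "i \<in> {1..length xs}" "j \<in> {1..length xs}" "i < j"
    then show "first_pos p (N i) < first_pos p (N j)"
      using key xs(2) by (auto simp: sorted_wrt_iff_nth_less)
  qed
  ultimately show thesis by (rule that)
qed

end

theory Submission
  imports Defs
begin

text \<open>Walk along the path and let a vertex have weight \<open>1\<close> or \<open>-1\<close> according to the parity of the
  number of negative edges met before it. A labelling inducing the given signs must separate the
  two weights by parity, so it exists iff the total weight \<open>D\<close> satisfies \<open>\<bar>D\<bar> \<le> 1\<close>.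
  Adding up the weights of the two ends of every edge counts each inner vertex twice; negative
  edges contribute \<open>0\<close> and positive ones twice the weight of an end, so
  \<open>2 D = 1 + w + 2 \<Sum> w(e)\<close>, where \<open>w\<close> is the weight of the last vertex and the sum runs over the
  positive edges. Even negative sections do not change the weight, hence a positive edge in
  \<open>Q\<^sub>i\<close> has weight \<open>(-1)\<^sup>i\<close>, and \<open>w = (-1)\<^sup>k\<close>.\<close>

section \<open>Balanced labellings\<close>

lemma bij_betw_matching_predicates:
  assumes "finite A" "finite B"
    and "card {x \<in> A. c x} = card {y \<in> B. d y}"
    and "card {x \<in> A. \<not> c x} = card {y \<in> B. \<not> d y}"
  shows "\<exists>f. bij_betw f A B \<and> (\<forall>x\<in>A. d (f x) = c x)"
proof -
  obtain g where g: "bij_betw g {x \<in> A. c x} {y \<in> B. d y}"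
    using assms finite_same_card_bij[of "{x \<in> A. c x}" "{y \<in> B. d y}"] by auto
  obtain h where h: "bij_betw h {x \<in> A. \<not> c x} {y \<in> B. \<not> d y}"
    using assms finite_same_card_bij[of "{x \<in> A. \<not> c x}" "{y \<in> B. \<not> d y}"] by auto
  define f where "f x = (if c x then g x else h x)" for x
  have g': "bij_betw f {x \<in> A. c x} {y \<in> B. d y}"
    using g by (rule bij_betw_cong[THEN iffD1, rotated]) (simp add: f_def)
  have h': "bij_betw f {x \<in> A. \<not> c x} {y \<in> B. \<not> d y}"
    using h by (rule bij_betw_cong[THEN iffD1, rotated]) (simp add: f_def)
  have "bij_betw f ({x \<in> A. c x} \<union> {x \<in> A. \<not> c x}) ({y \<in> B. d y} \<union> {y \<in> B. \<not> d y})"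
    using g' h' by (rule bij_betw_combine) auto
  moreover have "{x \<in> A. c x} \<union> {x \<in> A. \<not> c x} = A" "{y \<in> B. d y} \<union> {y \<in> B. \<not> d y} = B"
    by auto
  moreover have "d (f x) = c x" if "x \<in> A" for x
    using that bij_betwE[OF g'] bij_betwE[OF h'] by blast
  ultimately show ?thesis by auto
qed

lemma card_even_atLeast1AtMost: "card {x \<in> {1..n::nat}. even x} = n div 2"
proof (induction n)
  case (Suc n)
  have "{x \<in> {1..Suc n}. even x} =
      (if even (Suc n) then insert (Suc n) {x \<in> {1..n}. even x} else {x \<in> {1..n}. even x})"
    by (auto simp: le_Suc_eq)
  then show ?case using Suc by auto
qed simp

lemma card_filter_not:
  "finite A \<Longrightarrow> card {x \<in> A. P x} + card {x \<in> A. \<not> P x} = card A"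
  by (subst card_Un_disjoint[symmetric]) (auto intro: arg_cong[where f = card])

lemma card_odd_atLeast1AtMost: "card {x \<in> {1..n::nat}. odd x} = n - n div 2"
  using card_filter_not[of "{1..n}" even] card_even_atLeast1AtMost[of n] by simp

lemma sum_minus_one_power_eq_card:
  assumes "finite A"
  shows "(\<Sum>x\<in>A. (- 1) ^ g x) = int (card {x \<in> A. even (g x)}) - int (card {x \<in> A. odd (g x)})"
proof -
  have "(\<Sum>x\<in>A. (- 1) ^ g x) = (\<Sum>x\<in>A. (if even (g x) then 1 else 0) - (if odd (g x) then 1 else 0) :: int)"
    by (rule sum.cong) auto
  also have "\<dots> = int (card {x \<in> A. even (g x)}) - int (card {x \<in> A. odd (g x)})"
    using assms by (simp add: sum_subtractf sum.If_cases Int_def)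
  finally show ?thesis .
qed

lemma parity_labelling_exists_iff:
  fixes g :: "'a \<Rightarrow> nat"
  assumes "finite A"
  shows "(\<exists>f. bij_betw f A {1..card A} \<and> (\<forall>x\<in>A. \<forall>y\<in>A. even (f x) = even (f y) \<longleftrightarrow> even (g x) = even (g y)))
    \<longleftrightarrow> \<bar>\<Sum>x\<in>A. (- 1) ^ g x\<bar> \<le> (1::int)" (is "?L \<longleftrightarrow> ?R")
proof
  let ?n = "card A"
  have tot: "card {x \<in> A. even (g x)} + card {x \<in> A. odd (g x)} = ?n"
    using assms by (rule card_filter_not)
  have half: "a = n div 2 \<and> b = n - n div 2 \<or> b = n div 2 \<and> a = n - n div 2"
    if "a + b = n" "\<bar>int a - int b\<bar> \<le> 1" for a b n :: nat
  proof -
    have "a = b \<or> a = Suc b \<or> b = Suc a" using that(2) by linarith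
    then show ?thesis using that(1) by auto
  qed
  {
    assume ?L
    then obtain f where f: "bij_betw f A {1..?n}"
      and fg: "\<And>x y. x \<in> A \<Longrightarrow> y \<in> A \<Longrightarrow> even (f x) = even (f y) \<longleftrightarrow> even (g x) = even (g y)"
      by blast
    have "(\<Sum>x\<in>A. (- 1) ^ f x) = (\<Sum>x\<in>{1..?n}. (- 1) ^ x :: int)"
      using f by (rule sum.reindex_bij_betw)
    also have "\<dots> = int (?n div 2) - int (?n - ?n div 2)"
      by (subst sum_minus_one_power_eq_card)
        (simp_all only: card_even_atLeast1AtMost card_odd_atLeast1AtMost finite_atLeastAtMost)
    finally have le: "\<bar>\<Sum>x\<in>A. (- 1) ^ f x\<bar> \<le> (1::int)" by linarith
    show ?R
    proof (cases "A = {}")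
      case False
      then obtain z where z: "z \<in> A" by blast
      have "(- 1) ^ g x = (- 1) ^ (g z + f z) * ((- 1) ^ f x :: int)" if "x \<in> A" for x
        using fg[OF that z] by (cases "even (f x)"; cases "even (f z)"; cases "even (g x)"; cases "even (g z)") auto
      then have "(\<Sum>x\<in>A. (- 1) ^ g x) = (- 1) ^ (g z + f z) * (\<Sum>x\<in>A. (- 1) ^ f x :: int)"
        by (simp add: sum_distrib_left)
      then show ?thesis using le by (simp add: abs_mult power_abs)
    qed simp
  next
    assume ?R
    then have "\<bar>int (card {x \<in> A. even (g x)}) - int (card {x \<in> A. odd (g x)})\<bar> \<le> 1"
      using assms by (simp add: sum_minus_one_power_eq_card)
    with tot half consider
        "card {x \<in> A. even (g x)} = ?n div 2" "card {x \<in> A. odd (g x)} = ?n - ?n div 2"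
      | "card {x \<in> A. odd (g x)} = ?n div 2" "card {x \<in> A. even (g x)} = ?n - ?n div 2"
      by blast
    then show ?L
    proof cases
      case 1
      then have "\<exists>f. bij_betw f A {1..?n} \<and> (\<forall>x\<in>A. even (f x) = even (g x))"
        using assms card_even_atLeast1AtMost[of ?n] card_odd_atLeast1AtMost[of ?n]
        by (intro bij_betw_matching_predicates) simp_all
      then show ?thesis by metis
    next
      case 2
      then have "\<exists>f. bij_betw f A {1..?n} \<and> (\<forall>x\<in>A. even (f x) = odd (g x))"
        using assms card_even_atLeast1AtMost[of ?n] card_odd_atLeast1AtMost[of ?n]
        by (intro bij_betw_matching_predicates) simp_all
      then show ?thesis by metis
    qed
  }
qed

section \<open>Signed paths\<close>

lemma last_pos_subpath:
  assumes "distinct p" "a \<le> b" "b < length p"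
  shows "last_pos p (subpath p a b) = b"
proof -
  have "{j. j < length p \<and> p ! j \<in> verts (subpath p a b)} = {a..b}"
    using assms by (auto simp: subpath_def nth_eq_iff_index_eq)
  then show ?thesis using assms by (simp add: last_pos_def cSup_eq_Max[symmetric])
qed

lemma first_pos_subpath:
  assumes "distinct p" "a \<le> b" "b < length p"
  shows "first_pos p (subpath p a b) = a"
proof -
  have "{j. j < length p \<and> p ! j \<in> verts (subpath p a b)} = {a..b}"
    using assms by (auto simp: subpath_def nth_eq_iff_index_eq)
  then show ?thesis using assms by (simp add: first_pos_def cInf_eq_Min[symmetric])
qed

lemma inj_on_path_edge:
  assumes "distinct p"
  shows "inj_on (\<lambda>i. {p ! i, p ! Suc i}) {i. Suc i < length p}"
  using assms by (auto simp: inj_on_def doubleton_eq_iff nth_eq_iff_index_eq)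

lemma card_filter_edges_subpath:
  assumes "distinct p" "b < length p"
  shows "card {e \<in> edges (subpath p a b). R e} = card {i. a \<le> i \<and> i < b \<and> R {p ! i, p ! Suc i}}"
proof -
  have "{e \<in> edges (subpath p a b). R e} =
      (\<lambda>i. {p ! i, p ! Suc i}) ` {i. a \<le> i \<and> i < b \<and> R {p ! i, p ! Suc i}}"
    by (auto simp: subpath_def)
  moreover have "inj_on (\<lambda>i. {p ! i, p ! Suc i}) {i. a \<le> i \<and> i < b \<and> R {p ! i, p ! Suc i}}"
    by (rule inj_on_subset[OF inj_on_path_edge[OF assms(1)]]) (use assms in auto)
  ultimately show ?thesis by (simp add: card_image)
qed

lemma card_edges_subpath:
  assumes "distinct p" "b < length p"
  shows "card (edges (subpath p a b)) = b - a"
proof -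
  have "{i. a \<le> i \<and> i < b} = {a..<b}" by auto
  then show ?thesis using card_filter_edges_subpath[OF assms, of a "\<lambda>_. True"] by simp
qed

lemma connected_graph_subpath:
  assumes "a \<le> b"
  shows "connected_graph (subpath p a b)"
proof -
  let ?E = "{(x, y). {x, y} \<in> edges (subpath p a b)}"
  have fw: "(p ! a, p ! j) \<in> ?E\<^sup>*" if "a \<le> j" "j \<le> b" for j
    using that
  proof (induction j rule: dec_induct)
    case (step j)
    then have "(p ! j, p ! Suc j) \<in> ?E" by (auto simp: subpath_def)
    with step show ?case by (auto intro: rtrancl_into_rtrancl)
  qed simp
  have "sym ?E" by (auto simp: sym_def insert_commute)
  then have "sym (?E\<^sup>*)" by (rule sym_rtrancl)
  then have bw: "(p ! j, p ! a) \<in> ?E\<^sup>*" if "a \<le> j" "j \<le> b" for j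
    using fw[OF that] by (rule symD)
  have "(u, v) \<in> ?E\<^sup>*" if "u \<in> verts (subpath p a b)" "v \<in> verts (subpath p a b)" for u v
  proof -
    obtain i j where "u = p ! i" "v = p ! j" "a \<le> i" "i \<le> b" "a \<le> j" "j \<le> b"
      using \<open>u \<in> _\<close> \<open>v \<in> _\<close> by (auto simp: subpath_def)
    then show ?thesis using bw[of i] fw[of j] by (auto intro: rtrancl_trans)
  qed
  moreover have "verts (subpath p a b) \<noteq> {}" using assms by (simp add: subpath_def)
  ultimately show ?thesis unfolding connected_graph_def by blast
qed

lemma subgraph_subpath:
  assumes "distinct p" "a' \<le> a" "b \<le> b'" "b' < length p"
  shows "subgraph (subpath p a b) (subpath p a' b')"
proof -
  have "\<exists>u\<in>verts (subpath p a b). \<exists>v\<in>verts (subpath p a b). u \<noteq> v \<and> {p ! i, p ! Suc i} = {u, v}"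
    if "a \<le> i" "i < b" for i
    using that assms
    by (intro bexI[of _ "p ! i"] bexI[of _ "p ! Suc i"])
      (auto simp: subpath_def nth_eq_iff_index_eq)
  then have "simple_graph (subpath p a b)"
    by (auto simp: simple_graph_def subpath_def)
  with assms show ?thesis
    by (force simp: subgraph_def subpath_def)
qed

locale signed_path =
  fixes P :: "'a signed_graph" and p :: "'a list"
  assumes path: "path_along (graph_of P) p"
begin

definition neg :: "nat \<Rightarrow> bool" where
  "neg i \<longleftrightarrow> sign_of P {p ! i, p ! Suc i} = Negative"

definition neg_before :: "nat \<Rightarrow> nat" where
  "neg_before j = card {i. i < j \<and> neg i}"

definition neg_run :: "nat \<Rightarrow> nat \<Rightarrow> bool" where
  "neg_run a b \<longleftrightarrow> a \<le> b \<and> b < length p \<and> (\<forall>i. a \<le> i \<and> i < b \<longrightarrow> neg i) \<and>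
     (a = 0 \<or> \<not> neg (a - 1)) \<and> (b = length p - 1 \<or> \<not> neg b)"

lemma distinct: "distinct p" and nonempty: "0 < length p"
  and graph: "graph_of P = subpath p 0 (length p - 1)"
  using path by (auto simp: path_along_def)

lemma verts_eq: "verts (graph_of P) = set p"
proof -
  have "{0..length p - 1} = {..<length p}" using nonempty by (cases p) auto
  then show ?thesis using graph by (auto simp: subpath_def set_conv_nth)
qed

lemma edges_iff:
  "e \<in> edges (graph_of P) \<longleftrightarrow> (\<exists>i. Suc i < length p \<and> e = {p ! i, p ! Suc i})"
proof -
  have "i < length p - 1 \<longleftrightarrow> Suc i < length p" for i by auto
  then show ?thesis unfolding graph subpath_def by auto
qed

lemma not_neg_iff: "\<not> neg i \<longleftrightarrow> sign_of P {p ! i, p ! Suc i} = Positive"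
  by (cases "sign_of P {p ! i, p ! Suc i}") (auto simp: neg_def)

lemma neg_before_0 [simp]: "neg_before 0 = 0"
  by (simp add: neg_before_def)

lemma neg_before_Suc: "neg_before (Suc j) = (if neg j then Suc (neg_before j) else neg_before j)"
proof -
  have "{i. i < Suc j \<and> neg i} = (if neg j then insert j {i. i < j \<and> neg i} else {i. i < j \<and> neg i})"
    by (auto simp: less_Suc_eq)
  then show ?thesis by (auto simp: neg_before_def)
qed

lemma neg_before_run:
  assumes "a \<le> b" "\<And>i. a \<le> i \<Longrightarrow> i < b \<Longrightarrow> neg i"
  shows "neg_before b = neg_before a + (b - a)"
  using assms by (induction b rule: dec_induct) (auto simp: neg_before_Suc)

lemma labelling_induces_signs_iff:
  "(\<forall>u v. {u, v} \<in> edges (graph_of P) \<longrightarrow> sign_of P {u, v} = parity_sign f u v) \<longleftrightarrow>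
   (\<forall>i<length p. \<forall>j<length p. even (f (p ! i)) = even (f (p ! j)) \<longleftrightarrow> even (neg_before i) = even (neg_before j))"
   (is "?L \<longleftrightarrow> ?R")
proof
  assume ?L
  have step: "neg i \<longleftrightarrow> even (f (p ! i)) \<noteq> even (f (p ! Suc i))" if "Suc i < length p" for i
  proof -
    have "{p ! i, p ! Suc i} \<in> edges (graph_of P)"
      using that edges_iff by blast
    then have "sign_of P {p ! i, p ! Suc i} = parity_sign f (p ! i) (p ! Suc i)"
      using \<open>?L\<close> by blast
    then show ?thesis by (auto simp: neg_def parity_sign_def)
  qed
  have "even (f (p ! i)) = even (f (p ! 0)) \<longleftrightarrow> even (neg_before i)" if "i < length p" for i
    using that by (induction i) (auto simp: neg_before_Suc step)
  then show ?R by metis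
next
  assume R: ?R
  show ?L
  proof (intro allI impI)
    fix u v assume "{u, v} \<in> edges (graph_of P)"
    then obtain i where i: "Suc i < length p" "{u, v} = {p ! i, p ! Suc i}"
      using edges_iff by blast
    have "even (f (p ! i)) = even (f (p ! Suc i)) \<longleftrightarrow> \<not> neg i"
      using R i(1) by (auto simp: neg_before_Suc)
    moreover have "parity_sign f u v = parity_sign f (p ! i) (p ! Suc i)"
      using i(2) by (auto simp: doubleton_eq_iff parity_sign_def)
    ultimately show "sign_of P {u, v} = parity_sign f u v"
      using not_neg_iff[of i] i(2) by (auto simp: parity_sign_def neg_def)
  qed
qed

lemma bij_betw_nth_path: "bij_betw ((!) p) {..<length p} (set p)"
  using distinct by (simp add: bij_betw_nth)

lemma parity_signed_iff:
  "parity_signed P \<longleftrightarrow> \<bar>\<Sum>j<length p. (- 1) ^ neg_before j\<bar> \<le> (1::int)"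
proof -
  let ?n = "length p"
  let ?C = "\<lambda>h. \<forall>i<?n. \<forall>j<?n. even (h i) = even (h j :: nat) \<longleftrightarrow> even (neg_before i) = even (neg_before j)"
  have card: "card (set p) = ?n" using distinct by (rule distinct_card)
  have "parity_signed P \<longleftrightarrow> (\<exists>f. bij_betw f (set p) {1..?n} \<and> ?C (\<lambda>i. f (p ! i)))"
    unfolding parity_signed_def labelling_induces_signs_iff verts_eq card ..
  also have "\<dots> \<longleftrightarrow> (\<exists>h. bij_betw h {..<?n} {1..?n} \<and> ?C h)"
  proof
    assume "\<exists>f. bij_betw f (set p) {1..?n} \<and> ?C (\<lambda>i. f (p ! i))"
    then obtain f where "bij_betw f (set p) {1..?n}" "?C (\<lambda>i. f (p ! i))" by blast
    moreover from this(1) have "bij_betw (f \<circ> (!) p) {..<?n} {1..?n}"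
      using bij_betw_nth_path bij_betw_trans by blast
    ultimately show "\<exists>h. bij_betw h {..<?n} {1..?n} \<and> ?C h"
      by (intro exI[of _ "f \<circ> (!) p"]) simp
  next
    let ?q = "inv_into {..<?n} ((!) p)"
    assume "\<exists>h. bij_betw h {..<?n} {1..?n} \<and> ?C h"
    then obtain h where h: "bij_betw h {..<?n} {1..?n}" "?C h" by blast
    have "bij_betw (h \<circ> ?q) (set p) {1..?n}"
      using bij_betw_inv_into[OF bij_betw_nth_path] h(1) by (rule bij_betw_trans)
    moreover have "?q (p ! i) = i" if "i < ?n" for i
      using bij_betw_inv_into_left[OF bij_betw_nth_path] that by simp
    ultimately show "\<exists>f. bij_betw f (set p) {1..?n} \<and> ?C (\<lambda>i. f (p ! i))"
      using h(2) by (intro exI[of _ "h \<circ> ?q"]) simp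
  qed
  also have "\<dots> \<longleftrightarrow> \<bar>\<Sum>j<?n. (- 1) ^ neg_before j\<bar> \<le> (1::int)"
    using parity_labelling_exists_iff[of "{..<?n}" neg_before] by (simp add: Ball_def)
  finally show ?thesis .
qed

lemma twice_sum_weights:
  "2 * (\<Sum>j<Suc l. (- 1) ^ neg_before j) =
     (1::int) + (- 1) ^ neg_before l + 2 * (\<Sum>j | j < l \<and> \<not> neg j. (- 1) ^ neg_before j)"
proof (induction l)
  case (Suc l)
  have "{j. j < Suc l \<and> \<not> neg j} =
      (if neg l then {j. j < l \<and> \<not> neg j} else insert l {j. j < l \<and> \<not> neg j})"
    by (auto simp: less_Suc_eq)
  then show ?case using Suc by (simp add: neg_before_Suc algebra_simps)
qed simp

lemma neg_run_through:
  assumes "j < length p"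
  obtains a b where "neg_run a b" "a \<le> j" "j \<le> b"
proof -
  define L where "L a \<longleftrightarrow> a \<le> j \<and> (\<forall>i. a \<le> i \<and> i < j \<longrightarrow> neg i)" for a
  define a where "a = Least L"
  have "L j" by (auto simp: L_def)
  then have a: "L a" unfolding a_def by (rule LeastI)
  have a': "a = 0 \<or> \<not> neg (a - 1)"
  proof (rule ccontr)
    assume *: "\<not> ?thesis"
    have "neg i" if "a - 1 \<le> i" "i < j" for i
      using * a that by (cases "i = a - 1") (auto simp: L_def)
    then have "L (a - 1)" using a by (auto simp: L_def)
    then have "a \<le> a - 1" unfolding a_def by (rule Least_le)
    with * show False by auto
  qed
  define U where "U b \<longleftrightarrow> j \<le> b \<and> b < length p \<and> (\<forall>i. j \<le> i \<and> i < b \<longrightarrow> neg i)" for b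
  define b where "b = Greatest U"
  have bound: "\<And>y. U y \<Longrightarrow> y \<le> length p" by (simp add: U_def)
  have "U j" using assms by (auto simp: U_def)
  then have b: "U b" unfolding b_def using bound by (rule GreatestI_nat)
  have b': "b = length p - 1 \<or> \<not> neg b"
  proof (rule ccontr)
    assume "\<not> ?thesis"
    then have "U (Suc b)" using b by (auto simp: U_def less_Suc_eq)
    then have "Suc b \<le> b" unfolding b_def using bound by (rule Greatest_le_nat)
    then show False by simp
  qed
  have "neg_run a b"
    using a a' b b' unfolding neg_run_def L_def U_def by (metis le_trans not_le)
  then show thesis using a b that by (simp add: L_def U_def)
qed

lemma neg_run_unique:
  assumes "neg_run a b" "neg_run a' b'" "a \<le> b'" "a' \<le> b"
  shows "a = a' \<and> b = b'"
proof -
  have *: "b' \<le> b \<and> a \<le> a'" if "neg_run a b" "neg_run a' b'" "a \<le> b'" "a' \<le> b" for a b a' b'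
  proof (rule conjI; rule ccontr)
    assume "\<not> b' \<le> b"
    then have "neg b" "b \<noteq> length p - 1" using that by (auto simp: neg_run_def)
    then show False using that by (auto simp: neg_run_def)
  next
    assume "\<not> a \<le> a'"
    then have "a' \<le> a - 1" "a - 1 < b'" "a \<noteq> 0" using that by auto
    then show False using that by (auto simp: neg_run_def)
  qed
  show ?thesis using *[OF assms] *[OF assms(2,1,4,3)] by auto
qed

lemma signed_section_neg_run:
  assumes run: "neg_run a b"
  shows "signed_section Negative P (subpath p a b)"
proof -
  let ?H = "subpath p a b"
  have ab: "a \<le> b" "b < length p" and neg: "\<And>i. a \<le> i \<Longrightarrow> i < b \<Longrightarrow> neg i"
    using run by (auto simp: neg_run_def)
  have "monosigned Negative P ?H"
    unfolding monosigned_def graph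
    using ab neg by (auto intro!: subgraph_subpath connected_graph_subpath distinct)
      (auto simp: subpath_def neg_def)
  moreover have "K = ?H" if K: "monosigned Negative P K" and HK: "subgraph ?H K" for K
  proof -
    have edge: "\<exists>i. Suc i < length p \<and> neg i \<and> e = {p ! i, p ! Suc i}" if "e \<in> edges K" for e
    proof -
      have "e \<in> edges (graph_of P)" "sign_of P e = Negative"
        using K that by (auto simp: monosigned_def subgraph_def)
      then show ?thesis using edges_iff by (auto simp: neg_def)
    qed
    have closed: "y \<in> verts ?H" if "{x, y} \<in> edges K" "x \<in> verts ?H" for x y
    proof -
      obtain i where i: "Suc i < length p" "neg i" "{x, y} = {p ! i, p ! Suc i}"
        using edge[OF \<open>{x, y} \<in> _\<close>] by blast
      obtain j where j: "a \<le> j" "j \<le> b" "x = p ! j"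
        using \<open>x \<in> _\<close> by (auto simp: subpath_def)
      from i(3) consider "x = p ! i" "y = p ! Suc i" | "x = p ! Suc i" "y = p ! i"
        by (auto simp: doubleton_eq_iff)
      then show ?thesis
      proof cases
        case 1
        then have "j = i" using i j ab distinct by (simp add: nth_eq_iff_index_eq)
        moreover have "i \<noteq> b" using i run by (auto simp: neg_run_def)
        ultimately show ?thesis using 1 j by (auto simp: subpath_def)
      next
        case 2
        then have "j = Suc i" using i j ab distinct by (simp add: nth_eq_iff_index_eq)
        moreover have "Suc i \<noteq> a" using i run by (auto simp: neg_run_def)
        ultimately show ?thesis using 2 j by (auto simp: subpath_def)
      qed
    qed
    have start: "p ! a \<in> verts ?H" using ab by (auto simp: subpath_def)
    have "y \<in> verts ?H" if "y \<in> verts K" for y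
    proof -
      have "p ! a \<in> verts K" using start HK by (auto simp: subgraph_def)
      then have "(p ! a, y) \<in> {(x, y). {x, y} \<in> edges K}\<^sup>*"
        using K that by (auto simp: monosigned_def connected_graph_def)
      then show ?thesis
        by (induction rule: rtrancl_induct) (use start closed in auto)
    qed
    then have V: "verts K = verts ?H" using HK by (auto simp: subgraph_def)
    have "e \<in> edges ?H" if "e \<in> edges K" for e
    proof -
      obtain i where i: "Suc i < length p" "e = {p ! i, p ! Suc i}"
        using edge[OF \<open>e \<in> edges K\<close>] by blast
      have "e \<subseteq> verts K"
        using K that by (fastforce simp: monosigned_def subgraph_def simple_graph_def)
      then have "p ! i \<in> verts ?H" "p ! Suc i \<in> verts ?H" using V i by auto
      then have "a \<le> i" "Suc i \<le> b"
        using i ab distinct by (auto simp: subpath_def nth_eq_iff_index_eq)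
      then show ?thesis using i by (auto simp: subpath_def)
    qed
    then have "edges K = edges ?H" using HK by (auto simp: subgraph_def)
    with V show ?thesis by (simp add: prod_eq_iff)
  qed
  ultimately show ?thesis unfolding signed_section_def by blast
qed

lemma odd_negative_sections_eq:
  "odd_negative_sections P = {subpath p a b |a b. neg_run a b \<and> odd (b - a)}"
proof (intro set_eqI iffI)
  fix H assume "H \<in> odd_negative_sections P"
  then have H: "signed_section Negative P H" and o: "odd (card (edges H))"
    by (auto simp: odd_negative_sections_def)
  have "verts H \<noteq> {}" "verts H \<subseteq> set p"
    using H verts_eq by (auto simp: signed_section_def monosigned_def connected_graph_def subgraph_def)
  then obtain j where j: "j < length p" "p ! j \<in> verts H"
    by (metis ex_in_conv in_mono in_set_conv_nth)
  obtain a b where ab: "neg_run a b" "a \<le> j" "j \<le> b"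
    using neg_run_through[OF j(1)] .
  have "p ! j \<in> verts (subpath p a b)" using ab by (auto simp: subpath_def)
  then have "H = subpath p a b"
    using signed_section_unique[OF H signed_section_neg_run[OF ab(1)] j(2)] by blast
  moreover from this have "odd (b - a)"
    using o ab(1) distinct by (simp add: card_edges_subpath neg_run_def)
  ultimately show "H \<in> {subpath p a b |a b. neg_run a b \<and> odd (b - a)}" using ab by blast
next
  fix H assume "H \<in> {subpath p a b |a b. neg_run a b \<and> odd (b - a)}"
  then show "H \<in> odd_negative_sections P"
    using signed_section_neg_run distinct
    by (auto simp: odd_negative_sections_def card_edges_subpath neg_run_def)
qed

lemma even_neg_before_iff:
  assumes "j < length p" "j = length p - 1 \<or> \<not> neg j"
  shows "even (neg_before j) \<longleftrightarrow> even (card {b. b \<le> j \<and> (\<exists>a. neg_run a b \<and> odd (b - a))})"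
  using assms
proof (induction j rule: less_induct)
  case (less j)
  define E where "E j = {b. b \<le> j \<and> (\<exists>a. neg_run a b \<and> odd (b - a))}" for j
  obtain a b where ab: "neg_run a b" "a \<le> j" "j \<le> b"
    using neg_run_through[OF less.prems(1)] .
  have bj: "b = j"
  proof (rule ccontr)
    assume "b \<noteq> j"
    then have "j < b" using ab by simp
    then show False using ab less.prems by (auto simp: neg_run_def)
  qed
  have nb: "neg_before j = neg_before a + (j - a)"
    using ab bj by (intro neg_before_run) (auto simp: neg_run_def)
  have run_iff: "(\<exists>a'. neg_run a' b' \<and> odd (b' - a')) \<longleftrightarrow> b' = j \<and> odd (j - a)"
    if "a \<le> b'" "b' \<le> j" for b'
  proof
    assume "\<exists>a'. neg_run a' b' \<and> odd (b' - a')"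
    then obtain a' where a': "neg_run a' b'" "odd (b' - a')" by blast
    then have "a' \<le> b" using that bj by (auto simp: neg_run_def)
    then have "a = a' \<and> b = b'" using neg_run_unique[OF ab(1) a'(1)] that by simp
    then show "b' = j \<and> odd (j - a)" using a' bj by simp
  next
    assume "b' = j \<and> odd (j - a)"
    then show "\<exists>a'. neg_run a' b' \<and> odd (b' - a')" using ab bj by blast
  qed
  show ?case
  proof (cases "a = 0")
    case True
    then have "E j = (if odd (j - a) then {j} else {})"
      using run_iff by (auto simp: E_def)
    then have "even (neg_before j) \<longleftrightarrow> even (card (E j))" using nb True by simp
    then show ?thesis by (simp only: E_def)
  next
    case False
    have "\<not> neg (a - 1)" using False ab by (auto simp: neg_run_def)
    moreover have "a - 1 < j" "a - 1 < length p" using False ab less.prems by auto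
    ultimately have IH: "even (neg_before (a - 1)) \<longleftrightarrow> even (card (E (a - 1)))"
      using less.IH unfolding E_def by blast
    have nba: "neg_before a = neg_before (a - 1)"
      using neg_before_Suc[of "a - 1"] \<open>\<not> neg (a - 1)\<close> False by simp
    have Ej: "E j = (if odd (j - a) then insert j (E (a - 1)) else E (a - 1))"
    proof (rule set_eqI)
      fix x
      show "x \<in> E j \<longleftrightarrow> x \<in> (if odd (j - a) then insert j (E (a - 1)) else E (a - 1))"
      proof (cases "a \<le> x")
        case True
        then show ?thesis using run_iff[of x] False ab(2) by (auto simp: E_def)
      next
        case False
        then show ?thesis using ab(2) \<open>a - 1 < j\<close> by (auto simp: E_def)
      qed
    qed
    have "j \<notin> E (a - 1)" "finite (E (a - 1))" using \<open>a - 1 < j\<close> by (auto simp: E_def)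
    then have "even (neg_before j) \<longleftrightarrow> even (card (E j))"
      using IH by (simp add: nb nba Ej)
    then show ?thesis by (simp only: E_def)
  qed
qed

end

section \<open>The characterisation\<close>

theorem theorem4:
  fixes P :: "'a signed_graph" and p :: "'a list"
    and k :: nat and N Q :: "nat \<Rightarrow> 'a graph" and m :: "nat \<Rightarrow> nat" and m_o m_e :: int
  assumes path: "path_along (graph_of P) p"
    and sections: "N ` {1..k} = odd_negative_sections P"
    and in_order: "strict_mono_on {1..k} (\<lambda>i. first_pos p (N i))"
    and Q: "\<And>i. i \<le> k \<Longrightarrow> Q i = piece p k N i"
    and m: "\<And>i. i \<le> k \<Longrightarrow> m i = num_positive P (Q i)"
    and m_o: "m_o = (\<Sum>i | i \<le> k \<and> odd i. int (m i))"
    and m_e: "m_e = (\<Sum>i | i \<le> k \<and> even i. int (m i))"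
  shows "(parity_signed P \<longleftrightarrow>
            (if odd k then m_e - m_o \<in> {1, 0, -1} else m_e - m_o \<in> {0, -1, -2})) \<and>
         (k = 0 \<longrightarrow> (parity_signed P \<longleftrightarrow> num_positive P (graph_of P) = 0)) \<and>
         (k = 1 \<longrightarrow> (parity_signed P \<longleftrightarrow> \<bar>int (m 0) - int (m 1)\<bar> \<le> 1))"
proof -
  interpret signed_path P p by unfold_locales (rule path)
  define l where "l = length p - 1"
  have len: "length p = Suc l" using nonempty by (simp add: l_def)
  define A where "A i = first_pos p (N i)" for i
  define B where "B i = last_pos p (N i)" for i
  have run: "neg_run (A i) (B i) \<and> odd (B i - A i)" if "i \<in> {1..k}" for i
  proof -
    have "N i \<in> odd_negative_sections P" using sections that by blast
    then obtain a b where ab: "N i = subpath p a b" "neg_run a b" "odd (b - a)"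
      unfolding odd_negative_sections_eq by blast
    then have "A i = a" "B i = b"
      using distinct by (simp_all add: A_def B_def first_pos_subpath last_pos_subpath neg_run_def)
    with ab show ?thesis by simp
  qed
  have AB: "A i \<le> B i" "B i \<le> l" if "i \<in> {1..k}" for i
    using run[OF that] len by (auto simp: neg_run_def)
  have BA: "B i < A i'" if "i \<in> {1..k}" "i' \<in> {1..k}" "i < i'" for i i'
  proof (rule ccontr)
    assume "\<not> B i < A i'"
    moreover have lt: "A i < A i'"
      using in_order that by (auto simp: strict_mono_on_def A_def)
    ultimately have "A i = A i'"
      using neg_run_unique[of "A i" "B i" "A i'" "B i'"] run that AB[OF that(2)] by auto
    with lt show False by simp
  qed
  have B_mono: "B i < B i'" if "i \<in> {1..k}" "i' \<in> {1..k}" "i < i'" for i i'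
    using BA[OF that] AB[OF that(2)] by simp
  have B_range: "B ` {1..k} = {b. \<exists>a. neg_run a b \<and> odd (b - a)}"
  proof (intro equalityI subsetI)
    fix b assume "b \<in> {b. \<exists>a. neg_run a b \<and> odd (b - a)}"
    then obtain a where ab: "neg_run a b" "odd (b - a)" by blast
    then have "subpath p a b \<in> N ` {1..k}"
      unfolding sections odd_negative_sections_eq by blast
    then obtain i where "i \<in> {1..k}" "N i = subpath p a b" by auto
    then show "b \<in> B ` {1..k}"
      using ab distinct by (intro image_eqI[of _ _ i]) (simp_all add: B_def last_pos_subpath neg_run_def)
  qed (use run in blast)
  define t where "t j = card {i \<in> {1..k}. B i \<le> j}" for j
  have inj_B: "inj_on B {1..k}"
    by (rule inj_onI) (metis B_mono less_irrefl nat_neq_iff)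
  have t_eq: "t j = card {b. b \<le> j \<and> (\<exists>a. neg_run a b \<and> odd (b - a))}" for j
  proof -
    have "{b. b \<le> j \<and> (\<exists>a. neg_run a b \<and> odd (b - a))} = {b \<in> B ` {1..k}. b \<le> j}"
      unfolding B_range by auto
    also have "\<dots> = B ` {i \<in> {1..k}. B i \<le> j}" by auto
    finally show ?thesis
      by (simp only: t_def card_image[OF inj_on_subset[OF inj_B Collect_restrict]])
  qed
  have parity: "(- 1) ^ neg_before j = ((- 1) ^ t j :: int)" if "j \<le> l" "j = l \<or> \<not> neg j" for j
  proof -
    have "even (neg_before j) \<longleftrightarrow> even (t j)"
      unfolding t_eq by (rule even_neg_before_iff) (use that len in auto)
    then show ?thesis by (simp add: minus_one_power_iff)
  qed
  have t_le: "t j \<le> k" for j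
    using card_mono[OF _ Collect_restrict, of "{1..k}" "\<lambda>i. B i \<le> j"] by (simp add: t_def)
  have "{i \<in> {1..k}. B i \<le> l} = {1..k}" using AB by blast
  then have t_last: "t l = k" by (simp add: t_def)
  have t_iff: "t j = i \<longleftrightarrow> (i = 0 \<or> B i \<le> j) \<and> (i = k \<or> j < A (Suc i))"
    if "\<not> neg j" "j < l" "i \<le> k" for i j
  proof
    have below: "j < A i' \<longleftrightarrow> j < B i'" if "i' \<in> {1..k}" for i'
    proof -
      have "\<not> (A i' \<le> j \<and> j < B i')"
        using run[OF that] \<open>\<not> neg j\<close> unfolding neg_run_def by blast
      then show ?thesis using AB(1)[OF that] by linarith
    qed
    {
      assume *: "(i = 0 \<or> B i \<le> j) \<and> (i = k \<or> j < A (Suc i))"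
      have "i' \<in> {1..k} \<and> B i' \<le> j \<longleftrightarrow> i' \<in> {1..i}" for i'
      proof
        assume i': "i' \<in> {1..k} \<and> B i' \<le> j"
        show "i' \<in> {1..i}"
        proof (rule ccontr)
          assume "i' \<notin> {1..i}"
          then have "Suc i \<le> i'" "Suc i \<in> {1..k}" using i' \<open>i \<le> k\<close> by auto
          then have "B (Suc i) \<le> B i'" using B_mono[of "Suc i" i'] i' by (cases "Suc i = i'") auto
          moreover have "j < B (Suc i)" using * \<open>Suc i \<in> _\<close> below[of "Suc i"] by auto
          ultimately show False using i' by simp
        qed
      next
        assume i': "i' \<in> {1..i}"
        then have "B i' \<le> B i" using B_mono[of i' i] \<open>i \<le> k\<close> by (cases "i' = i") auto
        then show "i' \<in> {1..k} \<and> B i' \<le> j" using i' * \<open>i \<le> k\<close> by auto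
      qed
      then have "{i' \<in> {1..k}. B i' \<le> j} = {1..i}" by blast
      then show "t j = i" by (simp add: t_def)
    }
    assume ti: "t j = i"
    show "(i = 0 \<or> B i \<le> j) \<and> (i = k \<or> j < A (Suc i))"
    proof (rule conjI; rule ccontr)
      assume *: "\<not> (i = 0 \<or> B i \<le> j)"
      have "{i' \<in> {1..k}. B i' \<le> j} \<subseteq> {1..<i}"
      proof
        fix i' assume "i' \<in> {i' \<in> {1..k}. B i' \<le> j}"
        then show "i' \<in> {1..<i}"
          using * B_mono[of i i'] \<open>i \<le> k\<close> by (cases i i' rule: linorder_cases) auto
      qed
      from card_mono[OF _ this] have "t j \<le> i - 1" by (simp add: t_def)
      with ti * show False by auto
    next
      assume *: "\<not> (i = k \<or> j < A (Suc i))"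
      then have S: "Suc i \<in> {1..k}" using \<open>i \<le> k\<close> by auto
      then have "B (Suc i) \<le> j" using * below[of "Suc i"] by auto
      have "{1..Suc i} \<subseteq> {i' \<in> {1..k}. B i' \<le> j}"
      proof
        fix i' assume "i' \<in> {1..Suc i}"
        then show "i' \<in> {i' \<in> {1..k}. B i' \<le> j}"
          using B_mono[of i' "Suc i"] S \<open>B (Suc i) \<le> j\<close> by (cases "i' = Suc i") auto
      qed
      from card_mono[OF _ this] have "Suc i \<le> t j" by (simp add: t_def)
      with ti show False by simp
    qed
  qed
  define J where "J = {j. j < l \<and> \<not> neg j}"
  have m_eq: "m i = card {j \<in> J. t j = i}" if "i \<le> k" for i
  proof -
    let ?a = "if i = 0 then 0 else B i" and ?b = "if i = k then l else A (Suc i)"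
    have "?b \<le> l" using AB[of "Suc i"] that by auto
    then have "?b < length p" using len by simp
    moreover have "Q i = subpath p ?a ?b"
      using that by (simp add: Q piece_def A_def B_def l_def)
    ultimately have "m i = card {j. ?a \<le> j \<and> j < ?b \<and> \<not> neg j}"
      unfolding m[OF that] num_positive_def not_neg_iff
      by (simp only: card_filter_edges_subpath[OF distinct])
    also have "{j. ?a \<le> j \<and> j < ?b \<and> \<not> neg j} = {j \<in> J. t j = i}"
    proof (rule Collect_cong)
      fix j
      show "?a \<le> j \<and> j < ?b \<and> \<not> neg j \<longleftrightarrow> j \<in> J \<and> t j = i"
      proof (cases "j < l \<and> \<not> neg j")
        case True
        then show ?thesis using t_iff[of j i] that by (simp add: J_def)
      next
        case False
        then show ?thesis using \<open>?b \<le> l\<close> by (simp only: J_def) auto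
      qed
    qed
    finally show ?thesis .
  qed
  have "(\<Sum>j\<in>J. (- 1) ^ neg_before j :: int) = (\<Sum>j\<in>J. (- 1) ^ t j)"
    using parity by (intro sum.cong) (auto simp: J_def)
  also have "\<dots> = (\<Sum>i\<le>k. \<Sum>j | j \<in> J \<and> t j = i. (- 1) ^ t j)"
    using t_le by (intro sum.group[symmetric]) (auto simp: J_def)
  also have "\<dots> = (\<Sum>i\<le>k. (- 1) ^ i * int (m i))"
    by (intro sum.cong) (simp_all add: m_eq)
  also have "\<dots> = (\<Sum>i\<le>k. (if even i then int (m i) else 0) - (if odd i then int (m i) else 0))"
    by (intro sum.cong) auto
  also have "\<dots> = m_e - m_o"
    unfolding m_e m_o sum_subtractf
    by (subst (1 2) sum.inter_filter[symmetric]) (simp_all add: atMost_def)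
  finally have "2 * (\<Sum>j<length p. (- 1) ^ neg_before j :: int) = 1 + (- 1) ^ k + 2 * (m_e - m_o)"
    using twice_sum_weights[of l] parity[of l] t_last len by (simp add: J_def)
  then have main: "parity_signed P \<longleftrightarrow>
      (if odd k then m_e - m_o \<in> {1, 0, -1} else m_e - m_o \<in> {0, -1, -2})"
    unfolding parity_signed_iff by (cases "odd k") auto
  moreover have "parity_signed P \<longleftrightarrow> num_positive P (graph_of P) = 0" if "k = 0"
  proof -
    have sets: "{i. i \<le> k \<and> odd i} = {}" "{i. i \<le> k \<and> even i} = {0}"
      using that by (auto intro: odd_pos)
    have "m_e - m_o = int (m 0)" unfolding m_e m_o sets by simp
    moreover have "m 0 = num_positive P (graph_of P)"
      using m[of 0] Q[of 0] that graph by (simp add: piece_def)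
    ultimately show ?thesis using main that by auto
  qed
  moreover have "parity_signed P \<longleftrightarrow> \<bar>int (m 0) - int (m 1)\<bar> \<le> 1" if "k = 1"
  proof -
    have sets: "{i. i \<le> k \<and> odd i} = {1}" "{i. i \<le> k \<and> even i} = {0}"
      using that by (auto simp: le_Suc_eq)
    have "m_e - m_o = int (m 0) - int (m 1)" unfolding m_e m_o sets by simp
    then show ?thesis using main that by auto
  qed
  ultimately show ?thesis by blast
qed

end
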